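(* For every formula $\alpha$ of the language $\{\vee,\wedge,\neg,\square\}$: if $\models_{\cal TML}\alpha$, then $\vdash_{\mathbb T'}\alpha$.
   Context: $\mathfrak M_{4m}$ is the lattice $M_4=\{\mathbf 0,\mathbf n,\mathbf b,\mathbf 1\}$ ($\mathbf 0<\mathbf n,\mathbf b<\mathbf 1$, $\mathbf n,\mathbf b$ incomparable) with $\neg\mathbf 0=\mathbf 1$, $\neg\mathbf 1=\mathbf 0$, $\neg\mathbf n=\mathbf n$, $\neg\mathbf b=\mathbf b$, $\square\mathbf 1=\mathbf 1$, $\square x=\mathbf 0$ for $x\ne\mathbf 1$; it generates the variety of tetravalent modal algebras. Formulas are built from propositional variables with $\vee,\wedge,\neg,\square$; a valuation is a homomorphism $h$ into $\mathfrak M_{4m}$; $\models_{\cal TML}\alpha$ means $h(\alpha)=\mathbf 1$ for every valuation $h$. Signed formulas: $T(\alpha)$, $F(\alpha)$. Rules of $\mathbb T'$ (premise $\Rightarrow$ conclusion sets separated by $|$): $T(\alpha\vee\beta)\Rightarrow\{T(\alpha)\}|\{T(\beta)\}$; $T(\neg(\alpha\vee\beta))\Rightarrow\{T(\neg\alpha),T(\neg\beta)\}$; $F(\alpha\vee\beta)\Rightarrow\{F(\alpha),F(\beta)\}$; $F(\neg(\alpha\vee\beta))\Rightarrow\{F(\neg\alpha)\}|\{F(\neg\beta)\}$; $T(\alpha\wedge\beta)\Rightarrow\{T(\alpha),T(\beta)\}$; $T(\neg(\alpha\wedge\beta))\Rightarrow\{T(\neg\alpha)\}|\{T(\neg\beta)\}$;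 $F(\alpha\wedge\beta)\Rightarrow\{F(\alpha)\}|\{F(\beta)\}$; $F(\neg(\alpha\wedge\beta))\Rightarrow\{F(\neg\alpha),F(\neg\beta)\}$; $T(\neg\neg\alpha)\Rightarrow\{T(\alpha)\}$; $F(\neg\neg\alpha)\Rightarrow\{F(\alpha)\}$; $T(\square\alpha)\Rightarrow\{T(\alpha),F(\neg\alpha)\}$; $F(\square\alpha)\Rightarrow\{F(\alpha)\}|\{T(\neg\alpha)\}$; $T(\neg\square\alpha)\Rightarrow\{F(\square\alpha)\}$; $F(\neg\square\alpha)\Rightarrow\{T(\square\alpha)\}$. A tableau for $\eta$ is a finite tree with root $\eta$ built by repeatedly choosing a non-closed branch and a signed formula on it that is a rule premise, and extending the branch by one sub-branch per conclusion set. A branch is closed if it contains $T(\gamma)$ and $F(\gamma)$ for some $\gamma$; a tableau is closed if all branches are closed. $\vdash_{\mathbb T'}\alpha$ means there is a closed tableau of $\mathbb T'$ for $F(\alpha)$. *)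

theory Defs
  imports Main
begin

datatype m4 = Zero4 | N4 | B4 | One4

instantiation m4 :: lattice
begin

definition less_eq_m4 :: "m4 \<Rightarrow> m4 \<Rightarrow> bool" where
  "x \<le> y \<longleftrightarrow> x = y \<or> x = Zero4 \<or> y = One4"

definition less_m4 :: "m4 \<Rightarrow> m4 \<Rightarrow> bool" where
  "x < y \<longleftrightarrow> x \<le> y \<and> x \<noteq> (y :: m4)"

definition inf_m4 :: "m4 \<Rightarrow> m4 \<Rightarrow> m4" where
  "inf x y = (if x \<le> y then x else if y \<le> x then y else Zero4)"

definition sup_m4 :: "m4 \<Rightarrow> m4 \<Rightarrow> m4" where
  "sup x y = (if x \<le> y then y else if y \<le> x then x else One4)"

instance
proof
  fix x y z :: m4
  show "(x < y) = (x \<le> y \<and> \<not> y \<le> x)" "x \<le> x"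
    "inf x y \<le> x" "inf x y \<le> y" "x \<le> sup x y" "y \<le> sup x y"
    by (cases x; cases y; simp add: less_m4_def less_eq_m4_def inf_m4_def sup_m4_def)+
  show "x \<le> y \<Longrightarrow> y \<le> x \<Longrightarrow> x = y"
    by (auto simp: less_eq_m4_def)
  show "x \<le> y \<Longrightarrow> y \<le> z \<Longrightarrow> x \<le> z"
    "x \<le> y \<Longrightarrow> x \<le> z \<Longrightarrow> x \<le> inf y z"
    "y \<le> x \<Longrightarrow> z \<le> x \<Longrightarrow> sup y z \<le> x"
    by (cases x; cases y; cases z; simp add: less_eq_m4_def inf_m4_def sup_m4_def)+
qed

end

fun neg4 :: "m4 \<Rightarrow> m4" where
  "neg4 Zero4 = One4"
| "neg4 N4 = N4"
| "neg4 B4 = B4"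
| "neg4 One4 = Zero4"

definition box4 :: "m4 \<Rightarrow> m4" where
  "box4 x = (if x = One4 then One4 else Zero4)"

text \<open>The type parameter is the set of propositional variables.\<close>

datatype 'v fm =
    Var 'v
  | Or "'v fm" "'v fm"
  | And "'v fm" "'v fm"
  | Neg "'v fm"
  | Box "'v fm"

definition valuation :: "('v fm \<Rightarrow> m4) \<Rightarrow> bool" where
  "valuation h \<longleftrightarrow>
     (\<forall>\<alpha> \<beta>. h (Or \<alpha> \<beta>) = sup (h \<alpha>) (h \<beta>)) \<and>
     (\<forall>\<alpha> \<beta>. h (And \<alpha> \<beta>) = inf (h \<alpha>) (h \<beta>)) \<and>
     (\<forall>\<alpha>. h (Neg \<alpha>) = neg4 (h \<alpha>)) \<and>
     (\<forall>\<alpha>. h (Box \<alpha>) = box4 (h \<alpha>))"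

definition tml_valid :: "'v fm \<Rightarrow> bool" where
  "tml_valid \<alpha> \<longleftrightarrow> (\<forall>h. valuation h \<longrightarrow> h \<alpha> = One4)"

datatype 'v signed = T "'v fm" | F "'v fm"

text \<open>The second argument lists the conclusion sets of a rule; each set is
  given as the list of its elements.\<close>

inductive tableau_rule :: "'v signed \<Rightarrow> 'v signed list list \<Rightarrow> bool" where
  T_Or: "tableau_rule (T (Or \<alpha> \<beta>)) [[T \<alpha>], [T \<beta>]]"
| T_Neg_Or: "tableau_rule (T (Neg (Or \<alpha> \<beta>))) [[T (Neg \<alpha>), T (Neg \<beta>)]]"
| F_Or: "tableau_rule (F (Or \<alpha> \<beta>)) [[F \<alpha>, F \<beta>]]"
| F_Neg_Or: "tableau_rule (F (Neg (Or \<alpha> \<beta>))) [[F (Neg \<alpha>)], [F (Neg \<beta>)]]"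
| T_And: "tableau_rule (T (And \<alpha> \<beta>)) [[T \<alpha>, T \<beta>]]"
| T_Neg_And: "tableau_rule (T (Neg (And \<alpha> \<beta>))) [[T (Neg \<alpha>)], [T (Neg \<beta>)]]"
| F_And: "tableau_rule (F (And \<alpha> \<beta>)) [[F \<alpha>], [F \<beta>]]"
| F_Neg_And: "tableau_rule (F (Neg (And \<alpha> \<beta>))) [[F (Neg \<alpha>), F (Neg \<beta>)]]"
| T_Neg_Neg: "tableau_rule (T (Neg (Neg \<alpha>))) [[T \<alpha>]]"
| F_Neg_Neg: "tableau_rule (F (Neg (Neg \<alpha>))) [[F \<alpha>]]"
| T_Box: "tableau_rule (T (Box \<alpha>)) [[T \<alpha>, F (Neg \<alpha>)]]"
| F_Box: "tableau_rule (F (Box \<alpha>)) [[F \<alpha>], [T (Neg \<alpha>)]]"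
| T_Neg_Box: "tableau_rule (T (Neg (Box \<alpha>))) [[F (Box \<alpha>)]]"
| F_Neg_Box: "tableau_rule (F (Neg (Box \<alpha>))) [[T (Box \<alpha>)]]"

datatype 'a tree = Node 'a "'a tree list"

fun branches :: "'a tree \<Rightarrow> 'a list set" where
  "branches (Node a ts) =
     (if ts = [] then {[a]} else (#) a ` (\<Union>t \<in> set ts. branches t))"

definition closed_branch :: "'v signed list \<Rightarrow> bool" where
  "closed_branch b \<longleftrightarrow> (\<exists>\<gamma>. T \<gamma> \<in> set b \<and> F \<gamma> \<in> set b)"

definition closed_tableau :: "'v signed tree \<Rightarrow> bool" where
  "closed_tableau t \<longleftrightarrow> (\<forall>b \<in> branches t. closed_branch b)"

text \<open>A list of labels as a linear sub-branch, to be used as (part of) a list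
  of subtrees.\<close>

fun sub_branch :: "'a list \<Rightarrow> 'a tree list" where
  "sub_branch [] = []"
| "sub_branch (a # as) = [Node a (sub_branch as)]"

text \<open>In \<open>extends p t t'\<close> the list \<open>p\<close> is the path from the root of the whole
  tree to the parent of the root of \<open>t\<close>, and \<open>t'\<close> arises from \<open>t\<close> by a single
  rule application at one leaf; the rule premise may be anywhere on the branch
  ending in that leaf, including on \<open>p\<close>.\<close>

inductive extends ::
  "'v signed list \<Rightarrow> 'v signed tree \<Rightarrow> 'v signed tree \<Rightarrow> bool" where
  leaf: "\<lbrakk> \<not> closed_branch (p @ [a]); s \<in> set (p @ [a]); tableau_rule s Cs \<rbrakk>
    \<Longrightarrow> extends p (Node a []) (Node a (concat (map sub_branch Cs)))"
| inner: "extends (p @ [a]) t t'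
    \<Longrightarrow> extends p (Node a (us @ t # vs)) (Node a (us @ t' # vs))"

inductive tableau :: "'v signed \<Rightarrow> 'v signed tree \<Rightarrow> bool" for \<eta> where
  root: "tableau \<eta> (Node \<eta> [])"
| extend: "\<lbrakk> tableau \<eta> t; extends [] t t' \<rbrakk> \<Longrightarrow> tableau \<eta> t'"

definition tableau_provable :: "'v fm \<Rightarrow> bool" where
  "tableau_provable \<alpha> \<longleftrightarrow> (\<exists>t. tableau (F \<alpha>) t \<and> closed_tableau t)"

end

theory Submission
  imports Defs
begin

text \<open>Read \<open>T \<gamma>\<close> as ``the value of \<open>\<gamma>\<close> is \<open>B4\<close> or \<open>One4\<close>'' and \<open>F \<gamma>\<close> as its
  negation. Under this reading every rule is invertible: a valuation satisfying one of the
  conclusion sets satisfies the premise. Hence, if no valuation satisfies the signed formulas on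
  a branch, a premise may be replaced by each of its conclusion sets without losing
  unsatisfiability. Since a suitable weight decreases, this ends with signed variables and negated
  variables only, and an unsatisfiable set of those contains a pair \<open>T \<gamma>\<close>, \<open>F \<gamma>\<close>, because
  \<open>T\<close> and \<open>F\<close> of \<open>Var x\<close> and of \<open>Neg (Var x)\<close> can be prescribed independently by the
  four values.\<close>

fun eval :: "('v \<Rightarrow> m4) \<Rightarrow> 'v fm \<Rightarrow> m4" where
  "eval v (Var x) = v x"
| "eval v (Or \<alpha> \<beta>) = sup (eval v \<alpha>) (eval v \<beta>)"
| "eval v (And \<alpha> \<beta>) = inf (eval v \<alpha>) (eval v \<beta>)"
| "eval v (Neg \<alpha>) = neg4 (eval v \<alpha>)"
| "eval v (Box \<alpha>) = box4 (eval v \<alpha>)"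

lemma valuation_eval: "valuation (eval v)"
  by (simp add: valuation_def)

text \<open>The prime filter above \<open>B4\<close>. Whether \<open>x\<close> and
  \<open>neg4 x\<close> belong to it together determines \<open>x\<close>.\<close>

definition designated :: "m4 \<Rightarrow> bool" where
  "designated x \<longleftrightarrow> x = B4 \<or> x = One4"

lemma designated_sup: "designated (sup x y) \<longleftrightarrow> designated x \<or> designated y"
  by (cases x; cases y; simp add: designated_def sup_m4_def less_eq_m4_def)

lemma designated_inf: "designated (inf x y) \<longleftrightarrow> designated x \<and> designated y"
  by (cases x; cases y; simp add: designated_def inf_m4_def less_eq_m4_def)

lemma designated_neg_sup:
  "designated (neg4 (sup x y)) \<longleftrightarrow> designated (neg4 x) \<and> designated (neg4 y)"
  by (cases x; cases y; simp add: designated_def sup_m4_def less_eq_m4_def)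

lemma designated_neg_inf:
  "designated (neg4 (inf x y)) \<longleftrightarrow> designated (neg4 x) \<or> designated (neg4 y)"
  by (cases x; cases y; simp add: designated_def inf_m4_def less_eq_m4_def)

lemma neg4_neg4: "neg4 (neg4 x) = x"
  by (cases x) simp_all

text \<open>\<open>One4\<close> is the only designated value whose negation is not
  designated.\<close>

lemma designated_box: "designated (box4 x) \<longleftrightarrow> designated x \<and> \<not> designated (neg4 x)"
  by (cases x) (simp_all add: designated_def box4_def)

lemma designated_neg_box: "designated (neg4 (box4 x)) \<longleftrightarrow> \<not> designated (box4 x)"
  by (simp add: designated_def box4_def)

fun satisfies :: "('v \<Rightarrow> m4) \<Rightarrow> 'v signed \<Rightarrow> bool" where
  "satisfies v (T \<alpha>) \<longleftrightarrow> designated (eval v \<alpha>)"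
| "satisfies v (F \<alpha>) \<longleftrightarrow> \<not> designated (eval v \<alpha>)"

lemma tableau_rule_invertible:
  assumes "tableau_rule s Cs" "C \<in> set Cs" "\<forall>c \<in> set C. satisfies v c"
  shows "satisfies v s"
  using assms
  by cases (auto simp: designated_sup designated_inf designated_neg_sup designated_neg_inf
      neg4_neg4 designated_box designated_neg_box)

lemma tableau_rule_nonempty:
  assumes "tableau_rule s Cs"
  shows "Cs \<noteq> []" "[] \<notin> set Cs"
  using assms by (cases; simp)+

text \<open>Pushing a negation to both arguments costs 2, hence the \<open>+ 2\<close>;
  \<open>Box\<close> doubles because \<open>T_Box\<close> puts both \<open>\<alpha>\<close> and
  \<open>Neg \<alpha>\<close> on one branch.\<close>

primrec weight_fm :: "'v fm \<Rightarrow> nat" where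
  "weight_fm (Var x) = 1"
| "weight_fm (Or \<alpha> \<beta>) = weight_fm \<alpha> + weight_fm \<beta> + 2"
| "weight_fm (And \<alpha> \<beta>) = weight_fm \<alpha> + weight_fm \<beta> + 2"
| "weight_fm (Neg \<alpha>) = weight_fm \<alpha> + 1"
| "weight_fm (Box \<alpha>) = 2 * weight_fm \<alpha> + 2"

primrec weight :: "'v signed \<Rightarrow> nat" where
  "weight (T \<alpha>) = weight_fm \<alpha>"
| "weight (F \<alpha>) = weight_fm \<alpha>"

text \<open>Makes the measure drop when a literal is set aside without a rule application.\<close>

lemma weight_pos: "weight s > 0"
proof -
  have "weight_fm \<alpha> > 0" for \<alpha> :: "'a fm"
    by (cases \<alpha>) simp_all
  then show ?thesis
    by (cases s) simp_all
qed

lemma tableau_rule_weight: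
  assumes "tableau_rule s Cs" "C \<in> set Cs"
  shows "sum_list (map weight C) < weight s"
  using assms by cases auto

inductive literal :: "'v signed \<Rightarrow> bool" where
  "literal (T (Var x))"
| "literal (F (Var x))"
| "literal (T (Neg (Var x)))"
| "literal (F (Neg (Var x)))"

lemma literal_or_tableau_rule: "literal s \<or> (\<exists>Cs. tableau_rule s Cs)"
proof -
  have "literal (T \<alpha>) \<or> (\<exists>Cs. tableau_rule (T \<alpha>) Cs)" for \<alpha> :: "'a fm"
  proof (cases \<alpha>)
    case (Neg \<beta>)
    then show ?thesis
      by (cases \<beta>) (blast intro: literal.intros tableau_rule.intros)+
  qed (blast intro: literal.intros tableau_rule.intros)+
  moreover have "literal (F \<alpha>) \<or> (\<exists>Cs. tableau_rule (F \<alpha>) Cs)" for \<alpha> :: "'a fm"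
  proof (cases \<alpha>)
    case (Neg \<beta>)
    then show ?thesis
      by (cases \<beta>) (blast intro: literal.intros tableau_rule.intros)+
  qed (blast intro: literal.intros tableau_rule.intros)+
  ultimately show ?thesis
    by (cases s) blast+
qed

lemma open_literals_satisfiable:
  assumes lit: "\<forall>s \<in> L. literal s" and open_L: "\<nexists>\<gamma>. T \<gamma> \<in> L \<and> F \<gamma> \<in> L"
  shows "\<exists>v. \<forall>s \<in> L. satisfies v s"
proof -
  \<comment> \<open>The \<open>T\<close> literals alone decide the value: a missing one leaves its
    formula undesignated, with \<open>N4\<close> if both are missing. By openness this satisfies
    every \<open>F\<close> literal in \<open>L\<close>.\<close>
  define v where "v x =
    (if T (Var x) \<in> L then if T (Neg (Var x)) \<in> L then B4 else One4
     else if T (Neg (Var x)) \<in> L then Zero4 else N4)" for x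
  have "satisfies v s" if "s \<in> L" for s
    using bspec[OF lit that] that open_L
    by cases (auto simp: v_def designated_def)
  then show ?thesis
    by blast
qed

text \<open>Extensions are relative to the path \<open>p\<close> above \<open>t\<close>, so that
  subtrees can be closed separately and then assembled.\<close>

definition closable :: "'v signed list \<Rightarrow> 'v signed tree \<Rightarrow> bool" where
  "closable p t \<longleftrightarrow>
     (\<exists>t'. (extends p)\<^sup>*\<^sup>* t t' \<and> (\<forall>b \<in> branches t'. closed_branch (p @ b)))"

lemma closable_step: "extends p t t' \<Longrightarrow> closable p t' \<Longrightarrow> closable p t"
  unfolding closable_def by (meson converse_rtranclp_into_rtranclp)

lemma closable_closed_leaf: "closed_branch (p @ [a]) \<Longrightarrow> closable p (Node a [])"
  unfolding closable_def by (rule exI[of _ "Node a []"]) simp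

lemma extends_rtranclp_inner:
  assumes "(extends (p @ [a]))\<^sup>*\<^sup>* t t'"
  shows "(extends p)\<^sup>*\<^sup>* (Node a (us @ t # vs)) (Node a (us @ t' # vs))"
  using assms by (induction rule: rtranclp_induct)
    (auto intro: rtranclp.rtrancl_into_rtrancl extends.inner)

lemma extends_rtranclp_children:
  assumes "list_all2 (extends (p @ [a]))\<^sup>*\<^sup>* ts ts'"
  shows "(extends p)\<^sup>*\<^sup>* (Node a (us @ ts)) (Node a (us @ ts'))"
  using assms
proof (induction arbitrary: us rule: list_all2_induct)
  case Nil
  then show ?case by simp
next
  case (Cons t ts t' ts')
  have "(extends p)\<^sup>*\<^sup>* (Node a (us @ t # ts)) (Node a (us @ t' # ts))"
    using Cons.hyps(1) by (rule extends_rtranclp_inner)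
  \<comment> \<open>The finished child \<open>t'\<close> joins the prefix \<open>us\<close>, which
    is why the induction generalizes \<open>us\<close>.\<close>
  also have "(extends p)\<^sup>*\<^sup>* (Node a (us @ t' # ts)) (Node a (us @ t' # ts'))"
    using Cons.IH[of "us @ [t']"] by simp
  finally show ?case .
qed

text \<open>A step inside one child looks only at the path above it and at that child, so the
  children can be closed one after another. With \<open>ts\<close> empty, \<open>a\<close> would end
  a branch that need not be closed.\<close>

lemma closable_Node:
  assumes "ts \<noteq> []" "\<forall>t \<in> set ts. closable (p @ [a]) t"
  shows "closable p (Node a ts)"
proof -
  obtain f where f: "\<And>t. t \<in> set ts \<Longrightarrow> (extends (p @ [a]))\<^sup>*\<^sup>* t (f t)"
    "\<And>t b. t \<in> set ts \<Longrightarrow> b \<in> branches (f t) \<Longrightarrow> closed_branch (p @ [a] @ b)"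
    using assms(2) unfolding closable_def by (auto dest!: bchoice)
  have "list_all2 (extends (p @ [a]))\<^sup>*\<^sup>* ts (map f ts)"
    using f(1) by (auto simp: list_all2_conv_all_nth)
  then have "(extends p)\<^sup>*\<^sup>* (Node a ts) (Node a (map f ts))"
    using extends_rtranclp_children[of p a ts "map f ts" "[]"] by simp
  moreover have "\<forall>b \<in> branches (Node a (map f ts)). closed_branch (p @ b)"
    using assms(1) f(2) by auto
  ultimately show ?thesis
    unfolding closable_def by blast
qed

lemma sub_branch_eq_Nil: "sub_branch C = [] \<longleftrightarrow> C = []"
  by (cases C) simp_all

text \<open>After a rule application only the new leaves have to be treated; closability climbs up
  the chain from its last node.\<close>

lemma closable_sub_branch:
  assumes "C \<noteq> []" "closable (p @ butlast C) (Node (last C) [])" "t \<in> set (sub_branch C)"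
  shows "closable p t"
  using assms
proof (induction C arbitrary: p t)
  case Nil
  then show ?case by simp
next
  case (Cons c C)
  show ?case
  proof (cases "C = []")
    case True
    then show ?thesis using Cons.prems by simp
  next
    case False
    then have "\<forall>u \<in> set (sub_branch C). closable (p @ [c]) u"
      using Cons.IH[of "p @ [c]"] Cons.prems(2) by simp
    then show ?thesis
      using False Cons.prems(3) by (simp add: closable_Node sub_branch_eq_Nil)
  qed
qed

text \<open>\<open>\<Gamma>\<close> lists the signed formulas on the branch that are still to be decomposed and \<open>L\<close>
  collects the literals met so far; decomposed premises are in neither.\<close>

lemma closable_unsatisfiable_leaf:
  assumes "set \<Gamma> \<union> L \<subseteq> set (p @ [a])" "\<forall>s \<in> L. literal s"
    "\<nexists>v. \<forall>s \<in> set \<Gamma> \<union> L. satisfies v s"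
  shows "closable p (Node a [])"
  using assms
proof (induction "sum_list (map weight \<Gamma>)" arbitrary: \<Gamma> L p a rule: less_induct)
  case less
  show ?case
  proof (cases \<Gamma>)
    case Nil
    then obtain \<gamma> where "T \<gamma> \<in> L" "F \<gamma> \<in> L"
      using open_literals_satisfiable[OF less.prems(2)] less.prems(3) by auto
    then have "closed_branch (p @ [a])"
      using less.prems(1) unfolding closed_branch_def by blast
    then show ?thesis
      by (rule closable_closed_leaf)
  next
    case (Cons s \<Delta>)
    \<comment> \<open>Closed branches need their own case because \<open>extends.leaf\<close>
      applies to open ones only.\<close>
    consider "literal s" | "closed_branch (p @ [a])"
      | Cs where "\<not> closed_branch (p @ [a])" "tableau_rule s Cs"
      using literal_or_tableau_rule by blast
    then show ?thesis
    proof cases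
      case 1
      have "sum_list (map weight \<Delta>) < sum_list (map weight \<Gamma>)"
        using Cons weight_pos[of s] by simp
      then show ?thesis
        by (rule less.hyps[of _ "insert s L"]) (use less.prems Cons 1 in auto)
    next
      case 2
      then show ?thesis
        by (rule closable_closed_leaf)
    next
      case 3
      have "closable (p @ [a]) t" if C: "C \<in> set Cs" and t: "t \<in> set (sub_branch C)" for C t
      proof (rule closable_sub_branch[OF _ _ t])
        show "C \<noteq> []"
          using tableau_rule_nonempty(2)[OF 3(2)] C by auto
        then have path: "set ((p @ [a]) @ butlast C) \<union> {last C} = set (p @ [a]) \<union> set C"
          by (metis Un_assoc append_butlast_last_id empty_set list.simps(15) set_append)
        show "closable ((p @ [a]) @ butlast C) (Node (last C) [])"
        \<comment> \<open>The premise \<open>s\<close> stays on the branch but is no longer pending,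
          so the weight drops.\<close>
        proof (rule less.hyps[of "C @ \<Delta>" L])
          show "sum_list (map weight (C @ \<Delta>)) < sum_list (map weight \<Gamma>)"
            using tableau_rule_weight[OF 3(2) C] Cons by simp
          show "set (C @ \<Delta>) \<union> L \<subseteq> set (((p @ [a]) @ butlast C) @ [last C])"
            using less.prems(1) Cons path by auto
          show "\<forall>s \<in> L. literal s"
            by (rule less.prems(2))
          show "\<nexists>v. \<forall>s \<in> set (C @ \<Delta>) \<union> L. satisfies v s"
            using less.prems(3) Cons tableau_rule_invertible[OF 3(2) C] by auto
        qed
      qed
      moreover have "concat (map sub_branch Cs) \<noteq> []"
        using tableau_rule_nonempty[OF 3(2)] by (cases Cs) (auto simp: sub_branch_eq_Nil)
      ultimately have "closable p (Node a (concat (map sub_branch Cs)))"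
        by (intro closable_Node) auto
      moreover have "extends p (Node a []) (Node a (concat (map sub_branch Cs)))"
        using 3 less.prems(1) Cons by (intro extends.leaf) auto
      ultimately show ?thesis
        by (rule closable_step[rotated])
    qed
  qed
qed

lemma tableau_extends_rtranclp: "(extends [])\<^sup>*\<^sup>* t t' \<Longrightarrow> tableau \<eta> t \<Longrightarrow> tableau \<eta> t'"
  by (induction rule: rtranclp_induct) (auto intro: tableau.extend)

theorem theorem6p6:
  fixes \<alpha> :: "'v fm"
  assumes "tml_valid \<alpha>"
  shows "tableau_provable \<alpha>"
proof -
  \<comment> \<open>Validity forces the value \<open>One4\<close>, which is designated.\<close>
  have "\<nexists>v. \<forall>s \<in> set [F \<alpha>] \<union> {}. satisfies v s"
    using assms valuation_eval unfolding tml_valid_def by (auto simp: designated_def)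
  then have "closable [] (Node (F \<alpha>) [])"
    by (intro closable_unsatisfiable_leaf[of "[F \<alpha>]" "{}"]) auto
  then show ?thesis
    unfolding closable_def tableau_provable_def closed_tableau_def
    using tableau_extends_rtranclp[OF _ tableau.root] by fastforce
qed

end
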